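(* Let $C$ be a balanced curve system on a half-plane graph $G$, and let $F$ be a face of $G$. Then $|d_{C}(F)| \le d(F)$.
   Context: Fix a horizontal line in $\mathbb{R}^2$, called the boundary axis. A half-plane graph is a finite graph $G$ embedded in the closed half-plane below the boundary axis, taken up to planar isotopy fixing that axis, meeting the axis in a finite set of vertices. No condition is imposed on vertex degrees. The faces of $G$ are the connected components of the closed half-plane with $G$ removed; $U$ denotes the unbounded face. An arc on $G$ is an oriented, simple path in $G$ with both endpoints on the boundary axis; it is clockwise (resp. counterclockwise) if its terminal vertex is to the left (resp. right) of its initial vertex. A loop on $G$ is an oriented, simple closed path in $G$; it is clockwise or counterclockwise according to its orientation. A curve system on $G$ is a collection of arcs and loops on $G$. If $G$ is directed, the orientations of arcs and loops need not agree with the orientations of the edges they traverse. A curve encloses a face $F$ of $G$ if it separates $F$ from $U$ in the half-plane. A curve system $C$ on $G$ is balanced if for every edge $e$ of $G$ with endpoints $u$ and $v$, the number of curves of $C$ oriented from $u$ to $v$ along $e$ differs by at most $1$ from the number oriented from $v$ to $u$ along $e$. The dual graph $G^*$ is the undirected graph with one vertex for each face of $G$ and one edge $e^*$ for each edge $e$ of $G$, connecting the two faces on either side of $e$. The integral depth $d(F)$ of a face $F$ is the length of a shortest path from $U$ to $F$ in $G^*$. The depth $d_C(F)$ of $F$ with respect to a curve system $C$ is the number of clockwise curves of $C$ enclosing $F$ minus the number of counterclockwise curves of $C$ enclosing $F$.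
   Formalization: Each arc is assumed to meet the boundary axis only between its two endpoints, and each loop to meet it in at most one point; otherwise the claim fails (vertices a<b<c, edge bc, deeper edge ac; arcs b→c→a, c→b, c→b give depth 3 at integral depth 2). *)

theory Defs
  imports "HOL-Complex_Analysis.Winding_Numbers" "HOL-Library.Multiset" "HOL-Library.Extended_Nat"
begin

text \<open>
  The plane is \<^typ>\<open>complex\<close> and the boundary axis is the real line. Graphs may have parallel
  edges and self-loops; the orientation of the parametrisation of an edge carries no meaning beyond
  naming its two directions.
\<close>

definition half_plane :: "complex set"
  where "half_plane = {z. Im z \<le> 0}"

definition boundary_axis :: "complex set"
  where "boundary_axis = {z. Im z = 0}"

record 'e embedded_graph =
  verts :: "complex set"
  edges :: "'e set"
  embed :: "'e \<Rightarrow> real \<Rightarrow> complex"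

definition graph_image :: "'e embedded_graph \<Rightarrow> complex set"
  where "graph_image G = verts G \<union> (\<Union>e\<in>edges G. path_image (embed G e))"

definition edge_interior :: "'e embedded_graph \<Rightarrow> 'e \<Rightarrow> complex set"
  where "edge_interior G e = embed G e ` {0<..<1}"

definition half_plane_graph :: "'e embedded_graph \<Rightarrow> bool"
  where "half_plane_graph G \<longleftrightarrow>
    finite (verts G) \<and> finite (edges G) \<and>
    (\<forall>e\<in>edges G. simple_path (embed G e) \<and>
       pathstart (embed G e) \<in> verts G \<and> pathfinish (embed G e) \<in> verts G \<and>
       edge_interior G e \<inter> verts G = {}) \<and>
    (\<forall>e\<in>edges G. \<forall>e'\<in>edges G. e \<noteq> e' \<longrightarrow> edge_interior G e \<inter> edge_interior G e' = {}) \<and>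
    graph_image G \<subseteq> half_plane \<and>
    graph_image G \<inter> boundary_axis \<subseteq> verts G"

definition faces :: "'e embedded_graph \<Rightarrow> complex set set"
  where "faces G = components (half_plane - graph_image G)"

definition unbounded_face :: "'e embedded_graph \<Rightarrow> complex set"
  where "unbounded_face G = (THE F. F \<in> faces G \<and> \<not> bounded F)"


text \<open>
  A dart is an edge with a direction of traversal: \<^term>\<open>(e, True)\<close> follows the parametrisation
  of \<^term>\<open>e\<close>, \<^term>\<open>(e, False)\<close> runs against it. Curves are lists of darts. A loop is thus
  given together with a base vertex; nothing below depends on its choice.
\<close>

type_synonym 'e dart = "'e \<times> bool"

fun dart_path :: "'e embedded_graph \<Rightarrow> 'e dart \<Rightarrow> real \<Rightarrow> complex"
  where "dart_path G (e, b) = (if b then embed G e else reversepath (embed G e))"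

fun curve_path :: "'e embedded_graph \<Rightarrow> 'e dart list \<Rightarrow> real \<Rightarrow> complex"
  where
    "curve_path G [] = linepath 0 0"
  | "curve_path G [d] = dart_path G d"
  | "curve_path G (d # d' # ds) = dart_path G d +++ curve_path G (d' # ds)"

definition walk_on :: "'e embedded_graph \<Rightarrow> 'e dart list \<Rightarrow> bool"
  where "walk_on G c \<longleftrightarrow> c \<noteq> [] \<and> fst ` set c \<subseteq> edges G \<and>
    successively (\<lambda>d d'. pathfinish (dart_path G d) = pathstart (dart_path G d')) c"

definition initial_vertex :: "'e embedded_graph \<Rightarrow> 'e dart list \<Rightarrow> complex"
  where "initial_vertex G c = pathstart (dart_path G (hd c))"

definition terminal_vertex :: "'e embedded_graph \<Rightarrow> 'e dart list \<Rightarrow> complex"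
  where "terminal_vertex G c = pathfinish (dart_path G (last c))"

definition arc_on :: "'e embedded_graph \<Rightarrow> 'e dart list \<Rightarrow> bool"
  where "arc_on G c \<longleftrightarrow> walk_on G c \<and>
    distinct (map (\<lambda>d. pathstart (dart_path G d)) c @ [terminal_vertex G c]) \<and>
    initial_vertex G c \<in> boundary_axis \<and> terminal_vertex G c \<in> boundary_axis"

text \<open>
  Distinctness of the edges only matters for two darts: it excludes running along an edge and
  straight back.
\<close>

definition loop_on :: "'e embedded_graph \<Rightarrow> 'e dart list \<Rightarrow> bool"
  where "loop_on G c \<longleftrightarrow> walk_on G c \<and>
    terminal_vertex G c = initial_vertex G c \<and>
    distinct (map (\<lambda>d. pathstart (dart_path G d)) c) \<and> distinct (map fst c)"

definition clockwise :: "'e embedded_graph \<Rightarrow> 'e dart list \<Rightarrow> bool"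
  where "clockwise G c \<longleftrightarrow>
    arc_on G c \<and> Re (terminal_vertex G c) < Re (initial_vertex G c) \<or>
    loop_on G c \<and>
      (\<forall>z\<in>inside (path_image (curve_path G c)). winding_number (curve_path G c) z = - 1)"

definition counterclockwise :: "'e embedded_graph \<Rightarrow> 'e dart list \<Rightarrow> bool"
  where "counterclockwise G c \<longleftrightarrow>
    arc_on G c \<and> Re (initial_vertex G c) < Re (terminal_vertex G c) \<or>
    loop_on G c \<and>
      (\<forall>z\<in>inside (path_image (curve_path G c)). winding_number (curve_path G c) z = 1)"

definition encloses :: "'e embedded_graph \<Rightarrow> 'e dart list \<Rightarrow> complex set \<Rightarrow> bool"
  where "encloses G c F \<longleftrightarrow>
    (\<forall>x\<in>F. \<forall>y\<in>unbounded_face G.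
       \<not> connected_component (half_plane - path_image (curve_path G c)) x y)"

text \<open>
  A multiset, so that a collection may contain the same curve several times.
\<close>

definition curve_system :: "'e embedded_graph \<Rightarrow> 'e dart list multiset \<Rightarrow> bool"
  where "curve_system G C \<longleftrightarrow> (\<forall>c\<in>#C. arc_on G c \<or> loop_on G c)"

definition balanced :: "'e embedded_graph \<Rightarrow> 'e dart list multiset \<Rightarrow> bool"
  where "balanced G C \<longleftrightarrow>
    (\<forall>e\<in>edges G. \<bar>int (size {#c \<in># C. (e, True) \<in> set c#}) -
                    int (size {#c \<in># C. (e, False) \<in> set c#})\<bar> \<le> 1)"

text \<open>
  A curve that visits the axis in its course may cut off a region that lies outside the closed
  curve it forms (an arc being closed up above the axis): crossing the curve there need not change
  the number of enclosing curves. For example let \<open>a < b < c\<close> be the boundary vertices, joined by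
  an edge from \<open>b\<close> to \<open>c\<close> and an edge from \<open>a\<close> to \<open>c\<close> below it. The arcs \<open>b \<rightarrow> c \<rightarrow> a\<close>,
  \<open>c \<rightarrow> b\<close> and \<open>c \<rightarrow> b\<close> form a balanced system of clockwise curves that all enclose the face
  below the segment from \<open>b\<close> to \<open>c\<close>, although its integral depth is 2. The following condition
  excludes exactly such curves; it holds for arcs that meet the axis only in their endpoints and
  for loops that avoid the axis.
\<close>

definition proper_curve :: "'e embedded_graph \<Rightarrow> 'e dart list \<Rightarrow> bool"
  where "proper_curve G c \<longleftrightarrow>
    (arc_on G c \<longrightarrow>
      (\<forall>v \<in> path_image (curve_path G c) \<inter> boundary_axis.
         min (Re (initial_vertex G c)) (Re (terminal_vertex G c)) \<le> Re v \<and>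
         Re v \<le> max (Re (initial_vertex G c)) (Re (terminal_vertex G c)))) \<and>
    (loop_on G c \<longrightarrow> card (path_image (curve_path G c) \<inter> boundary_axis) \<le> 1)"

definition sides :: "'e embedded_graph \<Rightarrow> 'e \<Rightarrow> complex set set"
  where "sides G e = {F \<in> faces G. path_image (embed G e) \<subseteq> closure F}"

text \<open>
  An edge with the same face on both sides gives a dual self-loop: then \<open>F = F'\<close> below.
\<close>

definition dual_adj :: "'e embedded_graph \<Rightarrow> (complex set \<times> complex set) set"
  where "dual_adj G = {(F, F'). \<exists>e\<in>edges G. sides G e = {F, F'}}"

text \<open>
  The usual graph distance, infinite for unreachable vertices by convention (the dual graph of a
  half-plane graph is connected).
\<close>

definition integral_depth :: "'e embedded_graph \<Rightarrow> complex set \<Rightarrow> enat"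
  where "integral_depth G F = (INF n \<in> {n. (unbounded_face G, F) \<in> dual_adj G ^^ n}. enat n)"

definition depth :: "'e embedded_graph \<Rightarrow> 'e dart list multiset \<Rightarrow> complex set \<Rightarrow> int"
  where "depth G C F =
    int (size {#c \<in># C. clockwise G c \<and> encloses G c F#}) -
    int (size {#c \<in># C. counterclockwise G c \<and> encloses G c F#})"

end

theory Submission imports Defs begin

text \<open>
  Close every arc up by a semicircle above the axis, oriented so as to return to its initial vertex.
  By the Jordan curve theorem the contribution of a curve to the depth of a face is minus the
  winding number of the closed-up curve, and this is the sum of the winding numbers of its darts
  (and of the semicircle). Let \<open>F\<close> and \<open>F'\<close> be the two faces along an edge \<open>e\<close>, and let points of
  \<open>F\<close> and of \<open>F'\<close> tend to a common interior point of \<open>e\<close>. The winding numbers of all pieces other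
  than \<open>e\<close> are continuous there, so the difference of the contributions of a curve to \<open>F\<close> and \<open>F'\<close>
  is \<open>J\<close>, \<open>- J\<close> or \<open>0\<close> according to whether the curve traverses \<open>e\<close> forwards, backwards or not at
  all, with one integer \<open>J\<close> for all curves. As contributions are \<open>0\<close> or \<open>\<plusminus>1\<close> with a sign fixed by the
  curve, \<open>\<bar>J\<bar> \<le> 1\<close>, and balancedness bounds the change of depth across \<open>e\<close> by 1.
\<close>

subsection \<open>Components of the half-plane and insides of curves\<close>

lemma half_plane_closed [simp]: "closed half_plane" and half_plane_convex [simp]: "convex half_plane"
  unfolding half_plane_def by (simp_all add: closed_halfspace_Im_le convex_halfspace_Im_le)

text \<open>For \<open>R \<ge> 0\<close>, polar coordinates make the set the continuous image of a
  product of two intervals, radii above \<open>R\<close> and angles from \<open>-pi\<close> to 0.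
  For negative \<open>R\<close> the ball is empty.\<close>

lemma connected_half_plane_minus_cball: "connected (half_plane - cball 0 R)"
proof (cases "R < 0")
  case True
  then show ?thesis by (simp add: convex_connected)
next
  case False
  have eq: "half_plane - cball 0 R = (\<lambda>(r, t). rcis r t) ` ({R<..} \<times> {-pi..0})" (is "?L = ?f ` ?S")
  proof (intro equalityI subsetI)
    fix z assume z: "z \<in> ?L"
    \<comment> \<open>\<open>Arg\<close> is \<open>pi\<close> on the negative real axis; that value
      is moved to \<open>-pi\<close> so that all angles of the half-plane lie in one
      interval.\<close>
    define t where "t = (if Arg z = pi then - pi else Arg z)"
    have t: "cis t = cis (Arg z)"
      by (simp add: t_def complex_eq_iff)
    have "cmod z * sin (Arg z) \<le> 0"
      using z rcis_cmod_Arg[of z] by (metis DiffD1 Im_rcis half_plane_def mem_Collect_eq)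
    moreover have "cmod z > 0"
      using z False by auto
    ultimately have "sin (Arg z) \<le> 0"
      by (simp add: mult_le_0_iff)
    then have "t \<in> {-pi..0}"
      using Arg_bounded[of z] sin_gt_zero[of "Arg z"] by (fastforce simp: t_def)
    moreover have "z = rcis (cmod z) t"
      using rcis_cmod_Arg[of z] t by (simp add: rcis_def)
    ultimately show "z \<in> ?f ` ?S"
      using z by force
  next
    fix z assume "z \<in> ?f ` ?S"
    then obtain r t where rt: "z = rcis r t" "r > R" "-pi \<le> t" "t \<le> 0" by auto
    then have "sin t \<le> 0"
      using sin_ge_zero[of "-t"] by simp
    then have "Im z \<le> 0"
      using rt False by (simp add: mult_nonneg_nonpos)
    moreover have "cmod z > R"
      using rt False by (simp add: rcis_def norm_mult)
    ultimately show "z \<in> ?L"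
      by (simp add: half_plane_def)
  qed
  have "continuous_on ?S ?f"
    unfolding rcis_def case_prod_unfold by (intro continuous_intros)
  moreover have "connected ?S"
    by (intro convex_connected convex_Times convex_real_interval)
  ultimately show ?thesis
    unfolding eq by (rule connected_continuous_image)
qed

lemma half_plane_unbounded: "\<not> bounded (half_plane - cball 0 R)"
proof
  assume "bounded (half_plane - cball 0 R)"
  then have "bounded (half_plane - cball 0 R \<union> cball 0 R)"
    by (simp only: bounded_Un bounded_cball simp_thms)
  then obtain B where B: "\<And>z. z \<in> half_plane \<Longrightarrow> cmod z \<le> B"
    unfolding bounded_iff by blast
  show False
    using B[of "complex_of_real (\<bar>B\<bar> + 1)"] by (simp add: half_plane_def)
qed

lemma connected_component_Un:
  assumes "connected S" "connected T" "S \<subseteq> A" "T \<subseteq> A" "x \<in> S" "y \<in> T" "S \<inter> T \<noteq> {}"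
  shows "connected_component A x y"
proof -
  obtain z where z: "z \<in> S" "z \<in> T"
    using assms(7) by auto
  have "connected_component A x z" "connected_component A z y"
    unfolding connected_component_def using assms(1-6) z by auto
  then show ?thesis
    by (rule connected_component_trans)
qed

text \<open>The danger is a pocket of the half-plane that opens to infinity only across the axis.
  The hypothesis on axis points excludes it: an axis point off \<open>\<Gamma>\<close> is inside
  \<open>\<Gamma>\<close> or escapes to infinity along the axis. \<open>Y\<close> stands for the
  face at infinity.\<close>

lemma connected_component_iff_notin_inside:
  fixes \<Gamma> :: "complex set"
  assumes \<Gamma>: "compact \<Gamma>"
    and axis: "\<And>p. p \<in> boundary_axis \<Longrightarrow> p \<notin> \<Gamma> \<Longrightarrow>
      p \<in> inside \<Gamma> \<or> (\<exists>s\<in>{1, -1::real}. \<forall>t\<ge>0. p + of_real (s * t) \<notin> \<Gamma>)"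
    and x: "x \<in> half_plane - \<Gamma>"
    and Y: "Y \<subseteq> half_plane - \<Gamma>" "connected Y" "\<not> bounded Y" "y \<in> Y"
  shows "connected_component (half_plane - \<Gamma>) x y \<longleftrightarrow> x \<notin> inside \<Gamma>"
proof -
  define H where "H = half_plane - \<Gamma>"
  obtain R where R: "\<Gamma> \<subseteq> cball 0 R"
    using bounded_subset_ballD[OF compact_imp_bounded[OF \<Gamma>], of 0] ball_subset_cball by blast
  \<comment> \<open>Beyond a disc containing \<open>\<Gamma>\<close> the half-plane is connected, so
    all unbounded connected subsets of \<open>H\<close> lie in one component of
    \<open>H\<close>.\<close>
  define far where "far = half_plane - cball 0 R"
  have far: "connected far" "far \<subseteq> H" "\<not> bounded far"
    using R by (auto simp: far_def H_def connected_half_plane_minus_cball half_plane_unbounded)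
  have meets_far: "Z \<inter> far \<noteq> {}" if "\<not> bounded Z" "Z \<subseteq> H" for Z
    using that bounded_subset[OF bounded_cball, of Z 0 R] by (auto simp: far_def H_def)
  have unb: "connected_component H z y" if Z: "connected Z" "Z \<subseteq> H" "\<not> bounded Z" "z \<in> Z" for Z z
  proof -
    obtain u where u: "u \<in> Z" "u \<in> far"
      using meets_far[of Z] Z by auto
    have "connected_component H z u"
      unfolding connected_component_def using Z u by blast
    moreover have "connected_component H u y"
      using meets_far[of Y] Y far u
      by (intro connected_component_Un[of far Y]) (auto simp: H_def)
    ultimately show ?thesis
      by (rule connected_component_trans)
  qed
  have H_sub: "H \<subseteq> - \<Gamma>"
    by (auto simp: H_def)
  show ?thesis
  proof
    assume "connected_component (half_plane - \<Gamma>) x y"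
    moreover obtain u where u: "u \<in> far"
      using far(3) by fastforce
    moreover have "connected_component H u y"
      using unb[OF far u] .
    ultimately have "connected_component H x u"
      by (metis H_def connected_component_sym connected_component_trans)
    then have "connected_component (- \<Gamma>) x u"
      using H_sub by (rule connected_component_of_subset)
    moreover have "far \<subseteq> connected_component_set (- \<Gamma>) u"
      using far u H_sub by (intro connected_component_maximal) auto
    ultimately have "far \<subseteq> connected_component_set (- \<Gamma>) x"
      by (metis connected_component_eq mem_Collect_eq)
    then show "x \<notin> inside \<Gamma>"
      using far(3) bounded_subset by (auto simp: inside_def)
  next
    assume x_out: "x \<notin> inside \<Gamma>"
    define S where "S = connected_component_set H x"
    have S: "connected S" "S \<subseteq> H" "x \<in> S"
      using x connected_component_subset[of H x] by (auto simp: S_def H_def)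
    show "connected_component (half_plane - \<Gamma>) x y"
    proof (rule ccontr)
      assume nc: "\<not> connected_component (half_plane - \<Gamma>) x y"
      \<comment> \<open>Off the axis, \<open>S\<close> is open, so \<open>frontier S \<subseteq> \<Gamma>\<close> and \<open>S\<close> is even a bounded component of \<open>- \<Gamma>\<close>.\<close>
      have no_axis: "p \<notin> boundary_axis" if p: "p \<in> S" for p
      proof
        assume pa: "p \<in> boundary_axis"
        have p\<Gamma>: "p \<notin> \<Gamma>"
          using p S(2) by (auto simp: H_def)
        \<comment> \<open>\<open>inside \<Gamma>\<close> is a union of components of
          \<open>- \<Gamma>\<close>, and \<open>p\<close> and \<open>x\<close> share one.\<close>
        have "p \<notin> inside \<Gamma>"
        proof
          assume "p \<in> inside \<Gamma>"
          moreover have "connected_component (- \<Gamma>) p x"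
            using S p H_sub unfolding connected_component_def by blast
          ultimately show False
            using x_out x connected_component_eq[of x "- \<Gamma>" p] by (auto simp: inside_def)
        qed
        then obtain s :: real where s: "s \<in> {1, -1}" "\<And>t. t \<ge> 0 \<Longrightarrow> p + of_real (s * t) \<notin> \<Gamma>"
          using axis[OF pa] p\<Gamma> by blast
        \<comment> \<open>Running along the axis, the ray stays in the half-plane, so it joins
          \<open>p\<close>, and with it \<open>S\<close>, to infinity.\<close>
        define ray where "ray = (\<lambda>t. p + of_real (s * t)) ` {0..}"
        have "connected ray"
          unfolding ray_def
          by (intro connected_continuous_image continuous_intros convex_connected) auto
        moreover have "ray \<subseteq> H"
          using s pa by (auto simp: ray_def H_def half_plane_def boundary_axis_def)
        moreover have "\<not> bounded ray"
        proof
          assume "bounded ray"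
          then obtain B where B: "\<And>t. t \<ge> 0 \<Longrightarrow> cmod (p + of_real (s * t)) \<le> B"
            unfolding bounded_iff ray_def by blast
          define t where "t = \<bar>B\<bar> + cmod p + 1"
          have "cmod (of_real (s * t)) \<le> cmod (p + of_real (s * t)) + cmod p"
            using norm_triangle_ineq4[of "p + of_real (s * t)" p] by simp
          moreover have "t \<ge> 0" "\<bar>s\<bar> = 1"
            using s(1) by (auto simp: t_def)
          then have "cmod (of_real (s * t)) = t"
            by (simp only: norm_of_real abs_mult mult_1 abs_of_nonneg)
          ultimately show False
            using B[of t] by (simp add: t_def)
        qed
        moreover have "p \<in> ray"
          unfolding ray_def by (rule image_eqI[of _ _ 0]) auto
        ultimately have "connected_component H p y"
          using unb by blast
        then show False
          using nc p by (metis H_def S_def connected_component_trans mem_Collect_eq)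
      qed
      have "bounded S"
        using unb[OF S(1,2) _ S(3)] nc by (auto simp: H_def)
      have "frontier S \<subseteq> \<Gamma>"
      proof
        fix q assume q: "q \<in> frontier S"
        show "q \<in> \<Gamma>"
        proof (rule ccontr)
          assume q\<Gamma>: "q \<notin> \<Gamma>"
          have "closure S \<subseteq> half_plane"
            using S(2) by (intro closure_minimal) (auto simp: H_def)
          then have qH: "q \<in> H"
            using q q\<Gamma> by (auto simp: frontier_def H_def)
          \<comment> \<open>Components are relatively closed, so a point of \<open>H\<close> on the
            frontier of \<open>S\<close> belongs to \<open>S\<close>.\<close>
          have "closedin (top_of_set H) S"
            unfolding S_def by (rule closedin_connected_component)
          then obtain T where T: "closed T" "S = H \<inter> T"
            by (auto simp: closedin_closed)
          then have "closure S \<subseteq> T"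
            by (simp add: closure_minimal)
          then have qS: "q \<in> S"
            using q qH T by (auto simp: frontier_def)
          \<comment> \<open>As \<open>q\<close> is off the axis, it has a planar neighbourhood
            within \<open>H\<close>; this lies in \<open>S\<close> and makes \<open>q\<close> an
            interior point.\<close>
          define V where "V = {z. Im z < 0} - \<Gamma>"
          have "open V"
            unfolding V_def using \<Gamma> by (intro open_Diff compact_imp_closed open_halfspace_Im_lt)
          moreover have "q \<in> V"
            using qS no_axis[OF qS] qH by (auto simp: V_def H_def half_plane_def boundary_axis_def)
          ultimately obtain \<epsilon> where \<epsilon>: "\<epsilon> > 0" "ball q \<epsilon> \<subseteq> V"
            by (meson open_contains_ball)
          have "ball q \<epsilon> \<subseteq> H"
            using \<epsilon> by (auto simp: V_def H_def half_plane_def)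
          then have "ball q \<epsilon> \<subseteq> S"
            using qS \<epsilon> connected_component_maximal[of q "ball q \<epsilon>" H] connected_component_eq[of q H x]
            by (simp add: S_def)
          then have "q \<in> interior S"
            using \<epsilon> by (meson centre_in_ball mem_interior)
          with q show False
            by (auto simp: frontier_def)
        qed
      qed
      \<comment> \<open>A connected set that meets \<open>S\<close> but not its frontier stays in
        \<open>S\<close>, so the component of \<open>x\<close> in \<open>- \<Gamma>\<close> is
        bounded.\<close>
      then have "connected_component_set (- \<Gamma>) x \<inter> frontier S = {}"
        using connected_component_subset by fastforce
      moreover have "x \<in> connected_component_set (- \<Gamma>) x"
        using x by auto
      ultimately have "connected_component_set (- \<Gamma>) x \<subseteq> S"
        using connected_Int_frontier[of "connected_component_set (- \<Gamma>) x" S] S(3)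
          connected_connected_component by blast
      then show False
        using x_out x \<open>bounded S\<close> bounded_subset by (auto simp: inside_def)
    qed
  qed
qed

subsection \<open>Closing up arcs\<close>

text \<open>For \<open>l < r\<close> this is the upper semicircle over the segment from
  \<open>l\<close> to \<open>r\<close>, run counterclockwise from \<open>r\<close> back to
  \<open>l\<close>, so that it closes up an arc going from left to right.\<close>

definition closing_arc :: "real \<Rightarrow> real \<Rightarrow> real \<Rightarrow> complex"
  where "closing_arc l r = part_circlepath (of_real ((l + r) / 2)) ((r - l) / 2) 0 pi"

lemma closing_arc_ends [simp]:
  "pathstart (closing_arc l r) = of_real r" "pathfinish (closing_arc l r) = of_real l"
  by (simp_all add: closing_arc_def complex_eq_iff exp_eq_polar field_simps Re_exp Im_exp)

lemma arc_closing_arc: "l < r \<Longrightarrow> arc (closing_arc l r)"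
  unfolding closing_arc_def by (rule arc_part_circlepath) auto

lemma path_closing_arc [simp]: "path (closing_arc l r)"
  by (simp add: closing_arc_def)

lemma in_path_image_closing_arc:
  assumes "l < r" "z \<in> path_image (closing_arc l r)"
  shows "cmod (z - of_real ((l + r) / 2)) = (r - l) / 2" "0 \<le> Im z"
    "Im z = 0 \<Longrightarrow> z \<in> {of_real l, of_real r}"
proof -
  obtain t where t: "0 \<le> t" "t \<le> pi"
      "z = of_real ((l + r) / 2) + of_real ((r - l) / 2) * exp (\<i> * of_real t)"
    using assms(2) by (auto simp: closing_arc_def path_image_part_circlepath)
  have z: "z - of_real ((l + r) / 2) = rcis ((r - l) / 2) t"
    unfolding t(3) rcis_def cis_conv_exp by simp
  show c: "cmod (z - of_real ((l + r) / 2)) = (r - l) / 2"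
    unfolding z using assms(1) by simp
  have "Im z = (r - l) / 2 * sin t"
    using arg_cong[OF z, of Im] by simp
  moreover have "0 \<le> (r - l) / 2 * sin t"
    using assms(1) sin_ge_zero[OF t(1,2)] by (intro mult_nonneg_nonneg) auto
  ultimately show "0 \<le> Im z"
    by (simp only:)
  assume "Im z = 0"
  then have "\<bar>Re z - (l + r) / 2\<bar> = (r - l) / 2"
    using c by (simp add: cmod_eq_Re)
  then have "Re z = l \<or> Re z = r"
    by (auto simp: abs_if field_simps split: if_splits)
  with \<open>Im z = 0\<close> show "z \<in> {of_real l, of_real r}"
    by (auto simp: complex_eq_iff)
qed

text \<open>As subpaths the two semicircles are the halves of a circle around \<open>c\<close>, so
  their winding numbers add up to that of the circle.\<close>

lemma winding_number_half_circles:
  assumes "cmod (z - c) < \<rho>"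
  shows "winding_number (part_circlepath c \<rho> 0 pi) z +
    winding_number (part_circlepath c \<rho> pi (2 * pi)) z = 1"
proof -
  have *: "part_circlepath c \<rho> 0 pi = subpath 0 (1/2) (circlepath c \<rho>)"
    "part_circlepath c \<rho> pi (2 * pi) = subpath (1/2) 1 (circlepath c \<rho>)"
    "circlepath c \<rho> = subpath 0 1 (circlepath c \<rho>)"
    by (auto simp: subpath_def circlepath_def part_circlepath_def linepath_def fun_eq_iff algebra_simps)
  have "z \<notin> path_image (circlepath c \<rho>)"
    using assms by (auto simp: path_image_circlepath dist_norm norm_minus_commute)
  then have "winding_number (subpath 0 (1/2) (circlepath c \<rho>)) z
      + winding_number (subpath (1/2) 1 (circlepath c \<rho>)) z
      = winding_number (subpath 0 1 (circlepath c \<rho>)) z"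
    by (intro winding_number_subpath_combine) auto
  then show ?thesis
    using winding_number_circlepath[OF assms] * by simp
qed

text \<open>Settles the sign that the Jordan curve theorem leaves open: evaluation at a point of the
  open upper half-disc shows that the closed-up arc is counterclockwise.\<close>

lemma winding_number_arc_closing_arc:
  assumes \<gamma>: "arc \<gamma>" "pathstart \<gamma> = of_real l" "pathfinish \<gamma> = of_real r" "l < r"
    and lower: "path_image \<gamma> \<subseteq> half_plane"
    and z: "Im z > 0" "cmod (z - of_real ((l + r) / 2)) < (r - l) / 2"
  shows "winding_number (\<gamma> +++ closing_arc l r) z = 1"
proof -
  define low where "low = part_circlepath (of_real ((l + r) / 2)) ((r - l) / 2) pi (2 * pi)"
  have low_ends: "pathstart low = of_real l" "pathfinish low = of_real r"
    using exp_two_pi_i by (simp_all add: low_def complex_eq_iff field_simps Re_exp Im_exp)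
  have low_path: "path low"
    by (simp add: low_def)
  have low_image: "path_image low \<subseteq> half_plane"
  proof
    fix w assume "w \<in> path_image low"
    then obtain t where t: "pi \<le> t" "t \<le> 2 * pi"
        "w = of_real ((l + r) / 2) + of_real ((r - l) / 2) * exp (\<i> * of_real t)"
      by (auto simp: low_def path_image_part_circlepath)
    have "sin t \<le> 0"
      using t sin_ge_zero[of "t - pi"] by (simp add: sin_diff)
    then show "w \<in> half_plane"
      unfolding t(3) half_plane_def using \<gamma>(4) by (simp add: Im_exp mult_nonneg_nonpos)
  qed
  have z_half: "z \<notin> half_plane"
    using z by (simp add: half_plane_def)
  have seg: "path_image (linepath (of_real r) (of_real l)) \<subseteq> half_plane"
    unfolding path_image_linepath
    by (intro closed_segment_subset) (auto simp: half_plane_def convex_halfspace_Im_le)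
  \<comment> \<open>Below \<open>z\<close> the arc may be replaced by the lower semicircle, which turns the closed curve into a circle.\<close>
  have chord: "winding_number g z = - winding_number (linepath (of_real r) (of_real l)) z"
    if g: "path g" "pathstart g = of_real l" "pathfinish g = of_real r" "path_image g \<subseteq> half_plane" for g
  proof -
    \<comment> \<open>The loop stays in a convex set that misses \<open>z\<close>, so it does not
      wind around \<open>z\<close>.\<close>
    have "winding_number (g +++ linepath (of_real r) (of_real l)) z = 0"
      using g seg z_half
      by (intro winding_number_zero_outside[of _ half_plane]) (auto simp: path_image_join)
    moreover have "winding_number (g +++ linepath (of_real r) (of_real l)) z =
        winding_number g z + winding_number (linepath (of_real r) (of_real l)) z"
      using g seg z_half by (intro winding_number_join) auto
    ultimately show ?thesis
      by (simp add: eq_neg_iff_add_eq_0)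
  qed
  have "winding_number \<gamma> z = winding_number low z"
    using chord[of \<gamma>] chord[of low] \<gamma> lower low_ends low_path low_image by (simp add: arc_imp_path)
  moreover have "winding_number (closing_arc l r) z + winding_number low z = 1"
    unfolding closing_arc_def low_def by (rule winding_number_half_circles[OF z(2)])
  moreover have "winding_number (\<gamma> +++ closing_arc l r) z
      = winding_number \<gamma> z + winding_number (closing_arc l r) z"
    using \<gamma> lower z_half z in_path_image_closing_arc(1)[OF \<gamma>(4), of z]
    by (intro winding_number_join) (auto simp: arc_imp_path)
  ultimately show ?thesis
    by (simp add: add.commute)
qed

text \<open>Arc and semicircle form a simple closed curve with winding number 1 inside and 0
  outside, which removes the same points from the half-plane as the arc alone. By
  \<open>between\<close>, an axis point off the curve lies under the semicircle, hence inside, or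
  beyond it with a free ray.\<close>

lemma winding_number_arc_connected_component:
  assumes \<gamma>: "arc \<gamma>" "pathstart \<gamma> = of_real l" "pathfinish \<gamma> = of_real r" "l < r"
    and lower: "path_image \<gamma> \<subseteq> half_plane"
    and between: "\<And>p. p \<in> path_image \<gamma> \<Longrightarrow> p \<in> boundary_axis \<Longrightarrow> l \<le> Re p \<and> Re p \<le> r"
    and x: "x \<in> half_plane - path_image \<gamma>"
    and Y: "Y \<subseteq> half_plane - path_image \<gamma>" "connected Y" "\<not> bounded Y" "y \<in> Y"
  shows "winding_number \<gamma> x + winding_number (closing_arc l r) x =
    (if connected_component (half_plane - path_image \<gamma>) x y then 0 else 1)"
proof -
  define g where "g = \<gamma> +++ closing_arc l r"
  have image: "path_image g = path_image \<gamma> \<union> path_image (closing_arc l r)"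
    unfolding g_def using \<gamma> by (intro path_image_join) simp
  have ends: "of_real l \<in> path_image \<gamma>" "of_real r \<in> path_image \<gamma>"
    using \<gamma> pathstart_in_path_image[of \<gamma>] pathfinish_in_path_image[of \<gamma>] by auto
  have meet: "w \<in> {of_real l, of_real r}"
    if "w \<in> half_plane" "w \<in> path_image (closing_arc l r)" for w
    using that in_path_image_closing_arc(2,3)[OF \<gamma>(4), of w] by (force simp: half_plane_def)
  have half_g: "half_plane - path_image g = half_plane - path_image \<gamma>"
    using meet ends by (auto simp: image)
  have simple: "simple_path g"
    unfolding g_def using \<gamma> arc_closing_arc[of l r] meet lower
    by (intro simple_path_join_loop) auto
  have loop: "pathfinish g = pathstart g"
    using \<gamma> by (simp add: g_def)
  \<comment> \<open>A point of the open upper half-disc, above the centre at half the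
    radius.\<close>
  define z0 where "z0 = Complex ((l + r) / 2) ((r - l) / 4)"
  have z0: "Im z0 > 0" "cmod (z0 - of_real ((l + r) / 2)) < (r - l) / 2"
    using \<gamma>(4) by (simp_all add: z0_def cmod_eq_Im)
  have w_z0: "winding_number g z0 = 1"
    unfolding g_def by (rule winding_number_arc_closing_arc[OF \<gamma> lower z0])
  have insideI: "w \<in> inside (path_image g)" if "w \<notin> path_image g" "winding_number g w \<noteq> 0" for w
    using that winding_number_zero_in_outside[OF simple_path_imp_path[OF simple] loop, of w]
    by (auto simp: inside_outside)
  have w_inside: "winding_number g w = 1" if "w \<in> inside (path_image g)" for w
  proof -
    have "z0 \<notin> path_image g"
      using z0 lower in_path_image_closing_arc(1)[OF \<gamma>(4), of z0] by (auto simp: image half_plane_def)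
    then have "z0 \<in> inside (path_image g)"
      using insideI w_z0 by simp
    then show ?thesis
      using simple_closed_path_winding_number_inside[OF simple] that w_z0
      by (metis one_neq_neg_one)
  qed
  have comp: "connected_component (half_plane - path_image g) x y \<longleftrightarrow> x \<notin> inside (path_image g)"
  proof (rule connected_component_iff_notin_inside)
    show "compact (path_image g)"
      using simple by (simp add: compact_simple_path_image)
  next
    fix p assume p: "p \<in> boundary_axis" "p \<notin> path_image g"
    have "p = of_real (Re p)"
      using p(1) by (simp add: boundary_axis_def complex_eq_iff)
    then have p_lr: "Re p \<noteq> l" "Re p \<noteq> r"
      using p(2) ends unfolding image by (metis UnI1)+
    consider "Re p < l" | "r < Re p" | "l < Re p" "Re p < r"
      using p_lr by linarith
    then show "p \<in> inside (path_image g) \<or> (\<exists>s\<in>{1, -1::real}. \<forall>t\<ge>0. p + of_real (s * t) \<notin> path_image g)"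
    proof cases
      case 1
      \<comment> \<open>Left of \<open>l\<close> the axis meets neither \<open>\<gamma>\<close>, by
        \<open>between\<close>, nor the semicircle.\<close>
      have "p + of_real (-1 * t) \<notin> path_image g" if "t \<ge> 0" for t
        using that 1 p meet[of "p + of_real (-1 * t)"] between[of "p + of_real (-1 * t)"] \<gamma>(4)
        by (auto simp: image boundary_axis_def half_plane_def complex_eq_iff)
      then show ?thesis by blast
    next
      case 2
      have "p + of_real (1 * t) \<notin> path_image g" if "t \<ge> 0" for t
        using that 2 p meet[of "p + of_real (1 * t)"] between[of "p + of_real (1 * t)"] \<gamma>(4)
        by (auto simp: image boundary_axis_def half_plane_def complex_eq_iff)
      then show ?thesis by blast
    next
      case 3
      \<comment> \<open>Apart from \<open>p\<close>, the segment runs above the axis and within the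
        open disc, so it meets neither the arc nor the semicircle; \<open>p\<close> and
        \<open>z0\<close> then have the same winding number.\<close>
      have "w \<notin> path_image g" if w: "w \<in> closed_segment p z0" for w
      proof (cases "w = p")
        case False
        obtain u where u: "0 \<le> u" "u \<le> 1" "w = (1 - u) *\<^sub>R p + u *\<^sub>R z0"
          using w by (auto simp: closed_segment_def)
        have "u \<noteq> 0"
          using u False by auto
        then have "Im w > 0"
          using u z0 p by (simp add: boundary_axis_def)
        moreover have "w \<in> ball (of_real ((l + r) / 2)) ((r - l) / 2)"
        proof -
          have "p \<in> ball (of_real ((l + r) / 2)) ((r - l) / 2)"
            using 3 p by (auto simp: dist_norm boundary_axis_def cmod_eq_Re abs_if field_simps)
          moreover have "z0 \<in> ball (of_real ((l + r) / 2)) ((r - l) / 2)"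
            using z0 by (simp add: dist_norm norm_minus_commute)
          ultimately show ?thesis
            using w closed_segment_subset[OF _ _ convex_ball] by blast
        qed
        ultimately show ?thesis
          using lower in_path_image_closing_arc(1)[OF \<gamma>(4), of w]
          by (auto simp: image half_plane_def dist_norm norm_minus_commute)
      qed (use p in simp)
      then have "winding_number g p = winding_number g z0"
        using simple loop
        by (intro winding_number_eq[of _ _ "closed_segment p z0"]) (auto simp: simple_path_imp_path)
      then show ?thesis
        using insideI[OF p(2)] w_z0 by simp
    qed
  qed (use x Y half_g in auto)
  have "winding_number g x = (if x \<in> inside (path_image g) then 1 else 0)"
    using w_inside insideI x half_g by auto
  moreover have "winding_number g x = winding_number \<gamma> x + winding_number (closing_arc l r) x"
    unfolding g_def using \<gamma> x half_g image by (intro winding_number_join) (auto simp: arc_imp_path)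
  ultimately show ?thesis
    using comp half_g by simp
qed

text \<open>To block both directions along the axis from \<open>p\<close>, the loop would need two
  axis points. Finiteness is stated separately because \<open>card\<close> of an infinite set is
  0.\<close>

lemma connected_component_loop_iff:
  assumes g: "simple_path g" "pathfinish g = pathstart g"
    and axis: "card (path_image g \<inter> boundary_axis) \<le> 1" "finite (path_image g \<inter> boundary_axis)"
    and x: "x \<in> half_plane - path_image g"
    and Y: "Y \<subseteq> half_plane - path_image g" "connected Y" "\<not> bounded Y" "y \<in> Y"
  shows "connected_component (half_plane - path_image g) x y \<longleftrightarrow> x \<notin> inside (path_image g)"
proof (rule connected_component_iff_notin_inside)
  fix p assume p: "p \<in> boundary_axis" "p \<notin> path_image g"
  have "\<exists>s\<in>{1, -1::real}. \<forall>t\<ge>0. p + of_real (s * t) \<notin> path_image g"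
  proof (rule ccontr)
    assume "\<not> ?thesis"
    then obtain t t' :: real where t: "t \<ge> 0" "p + of_real t \<in> path_image g"
        "t' \<ge> 0" "p - of_real t' \<in> path_image g"
      by auto
    then have "{p + of_real t, p - of_real t'} \<subseteq> path_image g \<inter> boundary_axis"
      using p by (auto simp: boundary_axis_def)
    moreover have "t \<noteq> 0"
      using t p by auto
    then have "p + of_real t \<noteq> p - of_real t'"
      using t by (auto simp: complex_eq_iff)
    ultimately have "2 \<le> card (path_image g \<inter> boundary_axis)"
      using card_mono[OF axis(2)] by (metis card_2_iff)
    then show False
      using axis(1) by simp
  qed
  then show "p \<in> inside (path_image g) \<or> (\<exists>s\<in>{1, -1::real}. \<forall>t\<ge>0. p + of_real (s * t) \<notin> path_image g)"
    by blast
qed (use x Y g in \<open>auto simp: compact_simple_path_image\<close>)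

subsection \<open>Curves on a half-plane graph\<close>

locale plane_graph =
  fixes G :: "'e embedded_graph"
  assumes graph: "half_plane_graph G"
begin

abbreviation src :: "'e dart \<Rightarrow> complex" where "src d \<equiv> pathstart (dart_path G d)"
abbreviation tgt :: "'e dart \<Rightarrow> complex" where "tgt d \<equiv> pathfinish (dart_path G d)"

lemma
  assumes "e \<in> edges G"
  shows simple_path_embed: "simple_path (embed G e)"
    and embed_ends: "pathstart (embed G e) \<in> verts G" "pathfinish (embed G e) \<in> verts G"
    and edge_interior_verts: "edge_interior G e \<inter> verts G = {}"
    and path_image_embed_subset: "path_image (embed G e) \<subseteq> graph_image G"
  using graph assms by (auto simp: half_plane_graph_def graph_image_def)

lemma finite_verts: "finite (verts G)"
  and graph_image_half_plane: "graph_image G \<subseteq> half_plane"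
  and graph_image_axis: "graph_image G \<inter> boundary_axis \<subseteq> verts G"
  using graph by (auto simp: half_plane_graph_def)

lemma path_image_embed:
  "path_image (embed G e) = edge_interior G e \<union> {pathstart (embed G e), pathfinish (embed G e)}"
proof -
  have "{0..1::real} = {0<..<1} \<union> {0, 1}"
    by auto
  then show ?thesis
    by (auto simp: path_image_def edge_interior_def pathstart_def pathfinish_def)
qed

lemma path_image_dart: "path_image (dart_path G d) = path_image (embed G (fst d))"
  by (cases d) simp

lemma dart_ends: "{src d, tgt d} = {pathstart (embed G (fst d)), pathfinish (embed G (fst d))}"
  by (cases d) auto

lemma simple_path_dart: "fst d \<in> edges G \<Longrightarrow> simple_path (dart_path G d)"
  by (cases d) (auto simp: simple_path_embed simple_path_reversepath)

lemma path_dart: "fst d \<in> edges G \<Longrightarrow> path (dart_path G d)"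
  using simple_path_dart simple_path_imp_path by blast

text \<open>Interiors of distinct edges are disjoint and contain no vertex, which leaves only common
  ends.\<close>

lemma dart_images_meet:
  assumes "fst d \<in> edges G" "fst d' \<in> edges G" "fst d \<noteq> fst d'"
  shows "path_image (dart_path G d) \<inter> path_image (dart_path G d') \<subseteq> {src d, tgt d} \<inter> {src d', tgt d'}"
proof -
  have "edge_interior G (fst d) \<inter> edge_interior G (fst d') = {}"
    using graph assms by (auto simp: half_plane_graph_def)
  then show ?thesis
    unfolding path_image_dart dart_ends path_image_embed
    using edge_interior_verts[OF assms(1)] edge_interior_verts[OF assms(2)]
      embed_ends[OF assms(1)] embed_ends[OF assms(2)] by blast
qed

lemma walk_on_Cons:
  "walk_on G (d # d' # ds) \<longleftrightarrow> fst d \<in> edges G \<and> tgt d = src d' \<and> walk_on G (d' # ds)"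
  by (auto simp: walk_on_def)

lemma walk_on_single: "walk_on G [d] \<longleftrightarrow> fst d \<in> edges G"
  by (auto simp: walk_on_def)

lemma walk_on_edges: "walk_on G c \<Longrightarrow> d \<in> set c \<Longrightarrow> fst d \<in> edges G"
  by (auto simp: walk_on_def)

lemma curve_path_walk:
  assumes "walk_on G c"
  shows "path (curve_path G c) \<and> pathstart (curve_path G c) = initial_vertex G c \<and>
    pathfinish (curve_path G c) = terminal_vertex G c \<and>
    path_image (curve_path G c) = (\<Union>d\<in>set c. path_image (dart_path G d))"
  using assms
proof (induction c rule: induct_list012)
  case 1
  then show ?case by (simp add: walk_on_def)
next
  case (2 d)
  then show ?case
    by (simp add: initial_vertex_def terminal_vertex_def walk_on_single path_dart del: dart_path.simps)
next
  case (3 d d' ds)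
  have "walk_on G (d' # ds)" "tgt d = src d'" "path (dart_path G d)"
    using 3 by (auto simp: walk_on_Cons path_dart simp del: dart_path.simps)
  then show ?case
    using 3 by (simp add: initial_vertex_def terminal_vertex_def path_image_join del: dart_path.simps)
qed

lemma path_image_curve:
  assumes "walk_on G c"
  shows "path_image (curve_path G c) \<subseteq> graph_image G"
proof -
  have "path_image (dart_path G d) \<subseteq> graph_image G" if "d \<in> set c" for d
    using path_image_embed_subset[OF walk_on_edges[OF assms that]] by (simp add: path_image_dart)
  then show ?thesis
    using curve_path_walk[OF assms] by auto
qed

lemma walk_on_targets:
  assumes "walk_on G c" "d \<in> set c"
  shows "tgt d \<in> insert (terminal_vertex G c) (src ` set c)"
  using assms
proof (induction c rule: induct_list012)
  case (3 d1 d2 ds)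
  have "walk_on G (d2 # ds)" "tgt d1 = src d2"
    using 3 by (auto simp: walk_on_Cons simp del: dart_path.simps)
  then show ?case
    using 3 by (auto simp: terminal_vertex_def simp del: dart_path.simps)
qed (auto simp: terminal_vertex_def simp del: dart_path.simps)

text \<open>The start of a dart differs from all later vertices, so the dart shares no edge with the
  later ones and meets them only in its target. The curve is thus a join of arcs.\<close>

lemma simple_walk:
  assumes "walk_on G c" "distinct (map src c @ [terminal_vertex G c])"
  shows "arc (curve_path G c) \<and> distinct (map fst c)"
  using assms
proof (induction c rule: induct_list012)
  case 1
  then show ?case by (simp add: walk_on_def)
next
  case (2 d)
  then show ?case
    using simple_path_dart[of d]
    by (auto simp: terminal_vertex_def walk_on_single arc_simple_path simp del: dart_path.simps)
next
  case (3 d d' ds)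
  let ?c = "d' # ds"
  have w: "walk_on G ?c" "tgt d = src d'" "fst d \<in> edges G"
    using 3 by (auto simp: walk_on_Cons simp del: dart_path.simps)
  have t: "terminal_vertex G (d # ?c) = terminal_vertex G ?c"
    by (simp add: terminal_vertex_def)
  have IH: "arc (curve_path G ?c)" "distinct (map fst ?c)"
    using 3 w t by auto
  have fresh: "src d \<notin> insert (terminal_vertex G ?c) (src ` set ?c)"
    using "3.prems"(2) t by (auto simp del: dart_path.simps)
  then have off: "src d \<noteq> src d1 \<and> src d \<noteq> tgt d1" if "d1 \<in> set ?c" for d1
    using walk_on_targets[OF w(1) that] that by (metis imageI insertI2)
  \<comment> \<open>Both directions of an edge have the same set of ends, so a shared edge would
    make \<open>src d\<close> an end of \<open>d1\<close>.\<close>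
  have ne: "fst d \<noteq> fst d1" if "d1 \<in> set ?c" for d1
    using off[OF that] dart_ends[of d] dart_ends[of d1] by (metis insertE insertI1 singletonD)
  have meet: "path_image (dart_path G d) \<inter> path_image (dart_path G d1) \<subseteq> {src d'}"
    if "d1 \<in> set ?c" for d1
    using dart_images_meet[OF w(3) walk_on_edges[OF w(1) that] ne[OF that]] off[OF that]
    unfolding w(2) by blast
  have start: "pathstart (curve_path G ?c) = src d'"
    and image: "path_image (curve_path G ?c) = (\<Union>d\<in>set ?c. path_image (dart_path G d))"
    using curve_path_walk[OF w(1)] by (simp_all add: initial_vertex_def del: set_simps dart_path.simps)
  have "arc (dart_path G d)"
    using simple_path_dart[OF w(3)] off[of d'] w(2)
    by (auto simp: arc_simple_path simp del: dart_path.simps)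
  then have "arc (dart_path G d +++ curve_path G ?c)"
  proof (rule arc_join[OF _ IH(1)])
    show "tgt d = pathstart (curve_path G ?c)"
      using start w(2) by simp
    show "path_image (dart_path G d) \<inter> path_image (curve_path G ?c) \<subseteq> {pathstart (curve_path G ?c)}"
      unfolding start image using meet by blast
  qed
  moreover have "distinct (map fst (d # ?c))"
    using IH(2) ne by auto
  ultimately show ?case
    by simp
qed

lemma arc_curve:
  assumes "arc_on G c"
  shows "arc (curve_path G c)" "distinct (map fst c)"
  using simple_walk[of c] assms by (auto simp: arc_on_def)

text \<open>Without its first dart a loop is a simple walk, and the two resulting arcs meet only in
  their common ends. A loop of one dart is an edge whose ends coincide, already a simple closed
  path.\<close>

lemma loop_curve:
  assumes "loop_on G c"
  shows "simple_path (curve_path G c)" "pathfinish (curve_path G c) = pathstart (curve_path G c)"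
proof -
  have w: "walk_on G c" and loop: "terminal_vertex G c = initial_vertex G c"
    and dist: "distinct (map src c)" "distinct (map fst c)"
    using assms by (auto simp: loop_on_def)
  show "pathfinish (curve_path G c) = pathstart (curve_path G c)"
    using curve_path_walk[OF w] loop by simp
  show "simple_path (curve_path G c)"
  proof (cases "\<exists>d. c = [d]")
    case True
    then show ?thesis
      using w simple_path_dart by (auto simp: walk_on_single simp del: dart_path.simps)
  next
    case False
    then obtain d d' ds where c: "c = d # d' # ds"
      using w by (metis list.exhaust walk_on_def)
    let ?c = "d' # ds"
    have w': "walk_on G ?c" "tgt d = src d'" "fst d \<in> edges G"
      using w c by (auto simp: walk_on_Cons simp del: dart_path.simps)
    have t: "terminal_vertex G ?c = src d"
      using loop c by (simp add: terminal_vertex_def initial_vertex_def)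
    have arc: "arc (curve_path G ?c)"
      using simple_walk[OF w'(1)] dist(1) t c by auto
    have ends: "pathstart (curve_path G ?c) = src d'" "pathfinish (curve_path G ?c) = src d"
      and image: "path_image (curve_path G ?c) = (\<Union>d\<in>set ?c. path_image (dart_path G d))"
      using curve_path_walk[OF w'(1)] t
      by (simp_all add: initial_vertex_def del: set_simps dart_path.simps)
    have meet: "path_image (dart_path G d) \<inter> path_image (dart_path G d1) \<subseteq> {src d, src d'}"
      if "d1 \<in> set ?c" for d1
    proof -
      have "fst d \<noteq> fst d1"
        using dist(2) that c by (metis distinct.simps(2) imageI list.simps(9) set_map)
      then show ?thesis
        using dart_images_meet[OF w'(3) walk_on_edges[OF w'(1) that]] w'(2) by auto
    qed
    have "arc (dart_path G d)"
      using simple_path_dart[OF w'(3)] dist(1) c w'(2)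
      by (auto simp: arc_simple_path simp del: dart_path.simps)
    then have "simple_path (dart_path G d +++ curve_path G ?c)"
    proof (rule simple_path_join_loop[OF _ arc])
      show "path_image (dart_path G d) \<inter> path_image (curve_path G ?c)
          \<subseteq> {src d, pathstart (curve_path G ?c)}"
        unfolding ends image using meet by blast
    qed (use ends w'(2) in auto)
    then show ?thesis
      using c by simp
  qed
qed

lemma winding_number_curve:
  assumes "walk_on G c" "z \<notin> path_image (curve_path G c)"
  shows "winding_number (curve_path G c) z = (\<Sum>d\<leftarrow>c. winding_number (dart_path G d) z)"
  using assms
proof (induction c rule: induct_list012)
  case (3 d d' ds)
  have w: "walk_on G (d' # ds)" "tgt d = src d'" "path (dart_path G d)"
    using 3 by (auto simp: walk_on_Cons path_dart simp del: dart_path.simps)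
  note ends = curve_path_walk[OF w(1)]
  have start: "pathstart (curve_path G (d' # ds)) = tgt d"
    using ends w(2) by (simp add: initial_vertex_def)
  have z: "z \<notin> path_image (dart_path G d)" "z \<notin> path_image (curve_path G (d' # ds))"
    using "3.prems"(2) start by (auto simp: path_image_join simp del: dart_path.simps)
  have "winding_number (dart_path G d +++ curve_path G (d' # ds)) z =
      winding_number (dart_path G d) z + winding_number (curve_path G (d' # ds)) z"
    using w ends z start by (intro winding_number_join) auto
  then show ?case
    using 3 w z by simp
qed (auto simp: walk_on_def simp del: dart_path.simps)

lemma winding_number_dart:
  assumes "fst d \<in> edges G" "z \<notin> path_image (embed G (fst d))"
  shows "winding_number (dart_path G d) z =
    (if snd d then 1 else - 1) * winding_number (embed G (fst d)) z"
  using assms simple_path_embed[of "fst d"]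
  by (cases d) (auto simp: winding_number_reversepath simple_path_imp_path)

subsection \<open>The jump across an edge\<close>

text \<open>The net number of forward traversals of \<open>e\<close>: arcs and loops use each dart
  at most once, so membership already counts.\<close>

definition crossing :: "'e \<Rightarrow> 'e dart list \<Rightarrow> int"
  where "crossing e c = of_bool ((e, True) \<in> set c) - of_bool ((e, False) \<in> set c)"

text \<open>Isolates the summand that can jump across \<open>e\<close>; the winding numbers of darts
  on other edges are continuous at interior points of \<open>e\<close>.\<close>

lemma winding_number_curve_split:
  assumes c: "walk_on G c" "distinct c" and z: "z \<notin> graph_image G" and e: "e \<in> edges G"
  shows "winding_number (curve_path G c) z = of_int (crossing e c) * winding_number (embed G e) z
    + (\<Sum>d\<in>{d\<in>set c. fst d \<noteq> e}. winding_number (dart_path G d) z)"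
proof -
  let ?w = "\<lambda>d. winding_number (dart_path G d) z"
  have "winding_number (curve_path G c) z = (\<Sum>d\<in>set c. ?w d)"
    using winding_number_curve[OF c(1), of z] path_image_curve[OF c(1)] z c(2)
    by (auto simp: sum_list_distinct_conv_sum_set)
  also have "set c = set c \<inter> {(e, True), (e, False)} \<union> {d \<in> set c. fst d \<noteq> e}"
    by auto
  also have "sum ?w \<dots> = sum ?w (set c \<inter> {(e, True), (e, False)}) + sum ?w {d \<in> set c. fst d \<noteq> e}"
    by (rule sum.union_disjoint) auto
  also have "sum ?w (set c \<inter> {(e, True), (e, False)}) =
      (\<Sum>d\<in>{(e, True), (e, False)}. if d \<in> set c then ?w d else 0)"
    by (subst Int_commute, rule sum.inter_restrict) simp
  also have "\<dots> = of_int (crossing e c) * winding_number (embed G e) z"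
  proof -
    have "z \<notin> path_image (embed G e)"
      using z path_image_embed_subset[OF e] by auto
    then show ?thesis
      using winding_number_dart[of "(e, True)" z] winding_number_dart[of "(e, False)" z] e
      by (simp add: crossing_def del: dart_path.simps)
  qed
  finally show ?thesis .
qed

section \<open>Faces and enclosure\<close>

lemma faceD:
  assumes "F \<in> faces G"
  shows "F \<subseteq> half_plane - graph_image G" "connected F" "F \<noteq> {}"
  using assms in_components_subset in_components_connected in_components_nonempty
  unfolding faces_def by blast+

text \<open>Justifies the definite description: the half-plane outside a disc around the graph is
  connected, so it lies in a single face, and every unbounded face meets it.\<close>

lemma unbounded_face: "unbounded_face G \<in> faces G" "\<not> bounded (unbounded_face G)"
proof -
  have "bounded (graph_image G)"
    using graph simple_path_embed
    by (auto simp: graph_image_def half_plane_graph_def bounded_path_image simple_path_imp_path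
        finite_imp_bounded)
  then obtain R where R: "graph_image G \<subseteq> cball 0 R"
    using bounded_subset_ballD[of "graph_image G" 0] ball_subset_cball by blast
  define far where "far = half_plane - cball 0 R"
  have far: "connected far" "far \<subseteq> half_plane - graph_image G" "\<not> bounded far"
    using R by (auto simp: far_def connected_half_plane_minus_cball half_plane_unbounded)
  obtain u where u: "u \<in> far"
    using far(3) by fastforce
  define U where "U = connected_component_set (half_plane - graph_image G) u"
  have "far \<subseteq> U"
    unfolding U_def using far u by (intro connected_component_maximal)
  then have "U \<in> faces G \<and> \<not> bounded U"
    using far u bounded_subset by (auto simp: U_def faces_def componentsI)
  moreover have "F = U" if F: "F \<in> faces G \<and> \<not> bounded F" for F
  proof -
    have "\<not> F \<subseteq> cball 0 R"
      using F bounded_subset[OF bounded_cball] by blast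
    then obtain v where v: "v \<in> F" "v \<notin> cball 0 R"
      by blast
    then have "v \<in> far"
      using faceD(1)[of F] F by (auto simp: far_def)
    with v have "F \<inter> U \<noteq> {}"
      using \<open>far \<subseteq> U\<close> by auto
    then show ?thesis
      using F \<open>U \<in> faces G \<and> \<not> bounded U\<close> components_eq unfolding faces_def by blast
  qed
  ultimately have "unbounded_face G \<in> faces G \<and> \<not> bounded (unbounded_face G)"
    unfolding unbounded_face_def by (rule theI)
  then show "unbounded_face G \<in> faces G" "\<not> bounded (unbounded_face G)"
    by auto
qed

text \<open>A face is connected and misses the curve, so a single pair of points decides
  separation.\<close>

lemma encloses_iff:
  assumes c: "walk_on G c" and F: "F \<in> faces G" "x \<in> F" and y: "y \<in> unbounded_face G"
  shows "encloses G c F \<longleftrightarrow> \<not> connected_component (half_plane - path_image (curve_path G c)) x y"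
proof -
  let ?H = "half_plane - path_image (curve_path G c)"
  have same: "connected_component ?H v w" if "F' \<in> faces G" "v \<in> F'" "w \<in> F'" for F' v w
  proof -
    have "F' \<subseteq> ?H"
      using faceD(1)[OF that(1)] path_image_curve[OF c] by auto
    then show ?thesis
      unfolding connected_component_def using that faceD(2) by blast
  qed
  have "connected_component ?H x y" if "x' \<in> F" "y' \<in> unbounded_face G" "connected_component ?H x' y'" for x' y'
    using same[OF F(1) F(2) that(1)] that(3) same[OF unbounded_face(1) that(2) y]
      connected_component_trans by metis
  then show ?thesis
    unfolding encloses_def using F(2) y by blast
qed

section \<open>The contribution of a single curve as a winding number\<close>

definition contribution :: "'e dart list \<Rightarrow> complex set \<Rightarrow> int"
  where "contribution c F = of_bool (clockwise G c \<and> encloses G c F) -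
    of_bool (counterclockwise G c \<and> encloses G c F)"

lemma arc_not_loop: "arc_on G c \<Longrightarrow> \<not> loop_on G c"
  by (cases c) (auto simp: arc_on_def loop_on_def walk_on_def initial_vertex_def)

lemma arc_ends_real:
  assumes "arc_on G c"
  shows "pathstart (curve_path G c) = of_real (Re (initial_vertex G c))"
    "pathfinish (curve_path G c) = of_real (Re (terminal_vertex G c))"
    "Re (initial_vertex G c) \<noteq> Re (terminal_vertex G c)"
proof -
  have w: "walk_on G c"
    using assms by (simp add: arc_on_def)
  show s: "pathstart (curve_path G c) = of_real (Re (initial_vertex G c))"
    and t: "pathfinish (curve_path G c) = of_real (Re (terminal_vertex G c))"
    using assms curve_path_walk[OF w] by (auto simp: arc_on_def boundary_axis_def complex_eq_iff)
  show "Re (initial_vertex G c) \<noteq> Re (terminal_vertex G c)"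
    using s t arc_distinct_ends[OF arc_curve(1)[OF assms]] by auto
qed

text \<open>The correction \<open>\<kappa>\<close> depends on the curve but not on the face: it is 0
  for loops and plus or minus the winding number of the semicircle for arcs. It is continuous below
  the axis because the semicircle lies above. The minus sign arises since clockwise curves count
  positively.\<close>

lemma contribution_winding_number:
  assumes c: "arc_on G c \<or> loop_on G c" "proper_curve G c"
  obtains \<kappa> where "\<And>p. Im p < 0 \<Longrightarrow> isCont \<kappa> p"
    "\<And>F x. F \<in> faces G \<Longrightarrow> x \<in> F \<Longrightarrow>
      of_int (contribution c F) = - (winding_number (curve_path G c) x + \<kappa> x)"
proof -
  let ?g = "curve_path G c" and ?U = "unbounded_face G"
  have w: "walk_on G c"
    using c(1) by (auto simp: arc_on_def loop_on_def)
  have lower: "path_image ?g \<subseteq> half_plane"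
    using path_image_curve[OF w] graph_image_half_plane by auto
  obtain y where y: "y \<in> ?U"
    using faceD(3)[OF unbounded_face(1)] by auto
  have U: "?U \<subseteq> half_plane - path_image ?g" "connected ?U" "\<not> bounded ?U"
    using faceD[OF unbounded_face(1)] path_image_curve[OF w] unbounded_face(2) by auto
  have x_in: "x \<in> half_plane - path_image ?g" if "F \<in> faces G" "x \<in> F" for F x
    using faceD(1)[OF that(1)] that(2) path_image_curve[OF w] by auto
  have cont: "isCont (winding_number (closing_arc l r)) p" if "Im p < 0" "l < r" for l r p
    using in_path_image_closing_arc(2)[OF that(2), of p] that(1)
    by (intro continuous_at_winding_number) auto
  consider "loop_on G c" "\<not> arc_on G c" | "arc_on G c" "\<not> loop_on G c"
    using c(1) arc_not_loop by blast
  then show thesis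
  proof cases
    case 1
    note g = loop_curve[OF 1(1)]
    have "finite (path_image ?g \<inter> boundary_axis)"
      using path_image_curve[OF w] graph_image_axis finite_verts
      by (meson Int_mono finite_subset order_refl order_trans)
    moreover have "card (path_image ?g \<inter> boundary_axis) \<le> 1"
      using c(2) 1 by (simp add: proper_curve_def)
    ultimately have enc: "encloses G c F \<longleftrightarrow> x \<in> inside (path_image ?g)" if "F \<in> faces G" "x \<in> F" for F x
      using connected_component_loop_iff[OF g _ _ x_in[OF that] U y]
        encloses_iff[OF w that y] by blast
    \<comment> \<open>On an empty inside, both orientations of a loop would hold vacuously.\<close>
    have ins: "inside (path_image ?g) \<noteq> {}"
      using Jordan_inside_outside[OF g] by blast
    have "of_int (contribution c F) = - (winding_number ?g x + 0)" if F: "F \<in> faces G" "x \<in> F" for F x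
    proof (cases "x \<in> inside (path_image ?g)")
      case False
      then have "x \<in> outside (path_image ?g)"
        using x_in[OF F] by (simp add: outside_inside)
      then have "winding_number ?g x = 0"
        using g by (intro winding_number_zero_in_outside) (auto simp: simple_path_imp_path)
      then show ?thesis
        using enc[OF F] False by (simp add: contribution_def)
    next
      case True
      consider "\<forall>z\<in>inside (path_image ?g). winding_number ?g z = 1"
        | "\<forall>z\<in>inside (path_image ?g). winding_number ?g z = - 1"
        using simple_closed_path_winding_number_inside[OF g(1)] by blast
      then show ?thesis
      proof cases
        case a: 1
        then have "\<not> clockwise G c" "counterclockwise G c"
          using 1 ins by (auto simp: clockwise_def counterclockwise_def)
        then show ?thesis
          using enc[OF F] True a by (simp add: contribution_def)
      next
        case a: 2
        then have "clockwise G c" "\<not> counterclockwise G c"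
          using 1 ins by (auto simp: clockwise_def counterclockwise_def)
        then show ?thesis
          using enc[OF F] True a by (simp add: contribution_def)
      qed
    qed
    then show thesis
      using that[of "\<lambda>_. 0"] by simp
  next
    case 2
    note g = arc_curve(1)[OF 2(1)]
    define a b where "a = Re (initial_vertex G c)" and "b = Re (terminal_vertex G c)"
    note ends = arc_ends_real[OF 2(1), folded a_def b_def]
    have between: "min a b \<le> Re p \<and> Re p \<le> max a b" if "p \<in> path_image ?g" "p \<in> boundary_axis" for p
      using c(2) 2(1) that by (auto simp: proper_curve_def a_def b_def)
    show thesis
    proof (cases "a < b")
      case True
      have "\<not> clockwise G c" "counterclockwise G c"
        using 2 True by (auto simp: clockwise_def counterclockwise_def a_def b_def)
      then have "of_int (contribution c F) =
          - (winding_number ?g x + winding_number (closing_arc a b) x)" if F: "F \<in> faces G" "x \<in> F" for F x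
        using winding_number_arc_connected_component[OF g ends(1,2) True lower _ x_in[OF F] U y]
          between True encloses_iff[OF w F y] by (force simp: contribution_def)
      then show thesis
        using that[of "winding_number (closing_arc a b)"] cont[OF _ True] by blast
    next
      case False
      then have ba: "b < a"
        using ends(3) by simp
      have "clockwise G c" "\<not> counterclockwise G c"
        using 2 ba by (auto simp: clockwise_def counterclockwise_def a_def b_def)
      \<comment> \<open>Reversed, the arc goes from left to right and fits the semicircle; its
        winding number changes sign.\<close>
      moreover have "winding_number (reversepath ?g) x + winding_number (closing_arc b a) x =
          (if connected_component (half_plane - path_image ?g) x y then 0 else 1)"
        if F: "F \<in> faces G" "x \<in> F" for F x
        using winding_number_arc_connected_component[of "reversepath ?g" b a x ?U y]
          g ends ba lower between x_in[OF F] U y by (force simp: arc_reversepath)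
      moreover have "winding_number (reversepath ?g) x = - winding_number ?g x"
        if F: "F \<in> faces G" "x \<in> F" for F x
        using x_in[OF F] g by (simp add: winding_number_reversepath arc_imp_path)
      ultimately have "of_int (contribution c F) =
          - (winding_number ?g x + - winding_number (closing_arc b a) x)" if F: "F \<in> faces G" "x \<in> F" for F x
        using encloses_iff[OF w F y] F by (force simp: contribution_def)
      then show thesis
        using that[of "\<lambda>x. - winding_number (closing_arc b a) x"] cont[OF _ ba]
        by (simp add: continuous_minus)
    qed
  qed
qed

lemma contribution_diff_le:
  assumes "arc_on G c \<or> loop_on G c"
  shows "\<bar>contribution c F - contribution c F'\<bar> \<le> 1"
proof -
  have "\<not> (clockwise G c \<and> counterclockwise G c)"
  proof
    assume cc: "clockwise G c \<and> counterclockwise G c"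
    show False
    proof (cases "arc_on G c")
      case True
      then show False
        using cc arc_not_loop[OF True] by (auto simp: clockwise_def counterclockwise_def)
    next
      case False
      then have loop: "loop_on G c"
        using assms by simp
      obtain z where "z \<in> inside (path_image (curve_path G c))"
        using Jordan_inside_outside[OF loop_curve[OF loop]] by auto
      then show False
        using cc False unfolding clockwise_def counterclockwise_def
        by (metis one_neq_neg_one)
    qed
  qed
  then show ?thesis
    by (auto simp: contribution_def)
qed

section \<open>The common jump of all contributions across one edge\<close>

lemma distinct_darts:
  assumes "arc_on G c \<or> loop_on G c"
  shows "walk_on G c" "distinct c"
  using assms arc_curve(2)[of c] by (auto simp: arc_on_def loop_on_def distinct_map)

text \<open>\<open>J\<close> is independent of the curve because it is read off from the winding
  numbers of \<open>embed G e\<close> alone, along sequences in \<open>F\<close> and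
  \<open>F'\<close> tending to one point of \<open>e\<close>.\<close>

lemma contribution_jump:
  assumes e: "e \<in> edges G" and F: "F \<in> faces G" "path_image (embed G e) \<subseteq> closure F"
    and F': "F' \<in> faces G" "path_image (embed G e) \<subseteq> closure F'"
  obtains J :: int where "\<bar>J\<bar> \<le> 1"
    "\<And>c. arc_on G c \<or> loop_on G c \<Longrightarrow> proper_curve G c \<Longrightarrow>
      contribution c F - contribution c F' = J * crossing e c"
proof -
  define p where "p = embed G e (1/2)"
  have p_int: "p \<in> edge_interior G e"
    by (auto simp: p_def edge_interior_def)
  then have p_image: "p \<in> path_image (embed G e)"
    by (simp add: path_image_embed)
  have p_vert: "p \<notin> verts G"
    using p_int edge_interior_verts[OF e] by auto
  have p_graph: "p \<in> graph_image G"
    using p_image path_image_embed_subset[OF e] by auto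
  \<comment> \<open>The graph meets the axis only in vertices; this puts \<open>p\<close> where
    every \<open>\<kappa>\<close> is continuous.\<close>
  have p_Im: "Im p < 0"
    using p_graph graph_image_half_plane graph_image_axis p_vert
    by (force simp: half_plane_def boundary_axis_def)
  have p_off: "p \<notin> path_image (dart_path G d)" if "fst d \<in> edges G" "fst d \<noteq> e" for d
  proof -
    have "p \<notin> {src (e, True), tgt (e, True)}"
      using embed_ends[OF e] p_vert by auto
    then show ?thesis
      using dart_images_meet[of "(e, True)" d] that e p_image by (auto simp: path_image_dart)
  qed
  obtain x where x: "\<And>n. x n \<in> F" "x \<longlonglongrightarrow> p"
    using F(2) p_image closure_sequential by blast
  obtain x' where x': "\<And>n. x' n \<in> F'" "x' \<longlonglongrightarrow> p"
    using F'(2) p_image closure_sequential by blast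
  \<comment> \<open>No limit of \<open>t\<close> is known yet; a curve with nonzero crossing will
    supply one.\<close>
  define t where "t n = winding_number (embed G e) (x n) - winding_number (embed G e) (x' n)" for n
  have jump: "(\<lambda>n. of_int (crossing e c) * t n) \<longlonglongrightarrow> of_int (contribution c F' - contribution c F)"
    if c: "arc_on G c \<or> loop_on G c" "proper_curve G c" for c
  proof -
    note w = distinct_darts[OF c(1)]
    obtain \<kappa> where \<kappa>: "\<And>q. Im q < 0 \<Longrightarrow> isCont \<kappa> q"
      "\<And>F x. F \<in> faces G \<Longrightarrow> x \<in> F \<Longrightarrow>
        of_int (contribution c F) = - (winding_number (curve_path G c) x + \<kappa> x)"
      using contribution_winding_number[OF c] by blast
    \<comment> \<open>Everything but the part on \<open>e\<close>; being continuous at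
      \<open>p\<close>, it cancels in the limit.\<close>
    define f where "f z = (\<Sum>d\<in>{d\<in>set c. fst d \<noteq> e}. winding_number (dart_path G d) z) + \<kappa> z" for z
    have "isCont (winding_number (dart_path G d)) p" if "d \<in> {d\<in>set c. fst d \<noteq> e}" for d
      using that p_off walk_on_edges[OF w(1)]
      by (intro continuous_at_winding_number) (auto simp: path_dart simp del: dart_path.simps)
    then have cont: "isCont f p"
      unfolding f_def using \<kappa>(1)[OF p_Im] by (intro continuous_intros) auto
    have split: "of_int (contribution c F1) =
        - (of_int (crossing e c) * winding_number (embed G e) z + f z)"
      if "F1 \<in> faces G" "z \<in> F1" for F1 z
    proof -
      have "z \<notin> graph_image G"
        using faceD(1) that by auto
      then show ?thesis
        using \<kappa>(2)[OF that] winding_number_curve_split[OF w _ e, of z] by (simp add: f_def)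
    qed
    have "of_int (crossing e c) * t n =
        of_int (contribution c F' - contribution c F) + (f (x' n) - f (x n))" for n
      unfolding of_int_diff split[OF F(1) x(1)[of n]] split[OF F'(1) x'(1)[of n]]
      by (simp add: t_def algebra_simps)
    moreover have "(\<lambda>n. f (x' n) - f (x n)) \<longlonglongrightarrow> f p - f p"
      using x x' cont by (intro tendsto_diff isCont_tendsto_compose[of p f])
    then have "(\<lambda>n. of_int (contribution c F' - contribution c F) + (f (x' n) - f (x n)))
        \<longlonglongrightarrow> of_int (contribution c F' - contribution c F) + (f p - f p)"
      by (intro tendsto_add tendsto_const)
    ultimately show ?thesis
      by simp
  qed
  show thesis
  proof (cases "\<exists>c. (arc_on G c \<or> loop_on G c) \<and> proper_curve G c \<and> crossing e c \<noteq> 0")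
    case False
    have "contribution c F - contribution c F' = 0 * crossing e c"
      if c: "arc_on G c \<or> loop_on G c" "proper_curve G c" for c
    proof -
      have "crossing e c = 0"
        using False c by blast
      then have "(\<lambda>n::nat. 0::complex) \<longlonglongrightarrow> of_int (contribution c F' - contribution c F)"
        using jump[OF c] by simp
      then have "of_int (contribution c F' - contribution c F) = (0::complex)"
        using LIMSEQ_unique tendsto_const by blast
      then show ?thesis
        by (simp only: of_int_eq_0_iff mult_zero_left)
    qed
    then show thesis
      using that[of 0] by simp
  next
    case True
    then obtain c0 where c0: "arc_on G c0 \<or> loop_on G c0" "proper_curve G c0" "crossing e c0 \<noteq> 0"
      by blast
    have k0: "crossing e c0 * crossing e c0 = 1"
      using c0(3) by (auto simp: crossing_def split: if_splits)
    \<comment> \<open>As \<open>crossing e c0\<close> is its own inverse, multiplying by it recovers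
      \<open>t\<close> from the limit for \<open>c0\<close>; hence \<open>t\<close> tends to
      \<open>- J\<close>.\<close>
    define J where "J = crossing e c0 * (contribution c0 F - contribution c0 F')"
    have "\<bar>J\<bar> \<le> 1"
      using contribution_diff_le[OF c0(1), of F F'] k0
      by (auto simp: J_def abs_mult crossing_def split: if_splits)
    moreover have "contribution c F - contribution c F' = J * crossing e c"
      if c: "arc_on G c \<or> loop_on G c" "proper_curve G c" for c
    proof -
      have "(\<lambda>n. of_int (crossing e c0) * (of_int (crossing e c0) * t n))
          \<longlonglongrightarrow> of_int (crossing e c0) * of_int (contribution c0 F' - contribution c0 F)"
        by (intro tendsto_mult tendsto_const jump c0)
      moreover have "of_int (crossing e c0) * (of_int (crossing e c0) * t n) = t n" for n
        using k0 by (metis mult.assoc mult_1 of_int_1 of_int_mult)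
      moreover have "of_int (crossing e c0) * of_int (contribution c0 F' - contribution c0 F)
          = (- of_int J :: complex)"
        by (simp add: J_def algebra_simps)
      ultimately have "t \<longlonglongrightarrow> - of_int J"
        by simp
      then have "(\<lambda>n. of_int (crossing e c) * t n) \<longlonglongrightarrow> of_int (crossing e c) * (- of_int J)"
        by (intro tendsto_mult tendsto_const)
      then have "of_int (contribution c F' - contribution c F) = (of_int (crossing e c) * (- of_int J) :: complex)"
        using jump[OF c] LIMSEQ_unique by blast
      also have "\<dots> = of_int (- (J * crossing e c))"
        by simp
      finally have "contribution c F' - contribution c F = - (J * crossing e c)"
        by (simp only: of_int_eq_iff)
      then show ?thesis
        by simp
    qed
    ultimately show thesis
      using that by blast
  qed
qed

section \<open>Depth along walks in the dual graph\<close>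

lemma depth_eq_sum: "depth G C F = (\<Sum>c\<in>#C. contribution c F)"
  by (induction C) (auto simp: depth_def contribution_def)

text \<open>Turns the quantity bounded in \<open>balanced\<close> into the total crossing that
  appears when the jumps are summed.\<close>

lemma size_filter_diff_eq_sum:
  "int (size {#c \<in># C. (e, True) \<in> set c#}) - int (size {#c \<in># C. (e, False) \<in> set c#})
    = (\<Sum>c\<in>#C. crossing e c)"
  by (induction C) (auto simp: crossing_def)

text \<open>Summed over all curves, the jumps give \<open>J\<close> times the total crossing of the
  edge, and both factors have absolute value at most 1.\<close>

lemma depth_dual_adj:
  assumes "curve_system G C" "\<forall>c\<in>#C. proper_curve G c" "balanced G C" "(F, F') \<in> dual_adj G"
  shows "\<bar>depth G C F - depth G C F'\<bar> \<le> 1"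
proof -
  obtain e where e: "e \<in> edges G" "sides G e = {F, F'}"
    using assms(4) by (auto simp: dual_adj_def)
  then have "F \<in> sides G e" "F' \<in> sides G e"
    by auto
  then obtain J :: int where J: "\<bar>J\<bar> \<le> 1"
    "\<And>c. arc_on G c \<or> loop_on G c \<Longrightarrow> proper_curve G c \<Longrightarrow>
      contribution c F - contribution c F' = J * crossing e c"
    using contribution_jump[OF e(1), of F F'] by (auto simp: sides_def)
  have "depth G C F - depth G C F' = (\<Sum>c\<in>#C. contribution c F - contribution c F')"
    unfolding depth_eq_sum by (induction C) auto
  also have "\<dots> = (\<Sum>c\<in>#C. J * crossing e c)"
    using J(2) assms(1,2) by (intro arg_cong[where f = sum_mset] image_mset_cong)
      (auto simp: curve_system_def)
  also have "\<dots> = J * (\<Sum>c\<in>#C. crossing e c)"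
    by (simp add: sum_mset_distrib_left)
  finally have "\<bar>depth G C F - depth G C F'\<bar> = \<bar>J\<bar> * \<bar>\<Sum>c\<in>#C. crossing e c\<bar>"
    by (simp add: abs_mult)
  also have "\<dots> \<le> 1 * 1"
    using J(1) assms(3) e(1) unfolding balanced_def size_filter_diff_eq_sum
    by (intro mult_mono) auto
  finally show ?thesis
    by simp
qed

text \<open>No curve separates a point off it from itself, so none encloses the unbounded
  face.\<close>

lemma depth_unbounded_face:
  assumes "curve_system G C"
  shows "depth G C (unbounded_face G) = 0"
proof -
  obtain y where y: "y \<in> unbounded_face G"
    using faceD(3)[OF unbounded_face(1)] by auto
  have "\<not> encloses G c (unbounded_face G)" if "c \<in># C" for c
  proof -
    have w: "walk_on G c"
      using assms that distinct_darts(1) by (auto simp: curve_system_def)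
    have "y \<in> half_plane - path_image (curve_path G c)"
      using y faceD(1)[OF unbounded_face(1)] path_image_curve[OF w] by auto
    then show ?thesis
      using encloses_iff[OF w unbounded_face(1) y y] by auto
  qed
  then show ?thesis
    by (simp add: depth_eq_sum contribution_def sum_mset.neutral)
qed

lemma depth_le_walk_length:
  assumes "curve_system G C" "\<forall>c\<in>#C. proper_curve G c" "balanced G C"
    and "(unbounded_face G, F) \<in> dual_adj G ^^ n"
  shows "\<bar>depth G C F\<bar> \<le> int n"
  using assms(4)
proof (induction n arbitrary: F)
  case 0
  then show ?case
    using depth_unbounded_face[OF assms(1)] by simp
next
  case (Suc n)
  then obtain F1 where "(unbounded_face G, F1) \<in> dual_adj G ^^ n" "(F1, F) \<in> dual_adj G"
    by auto
  then show ?case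
    using Suc.IH[of F1] depth_dual_adj[OF assms(1-3), of F1 F] by simp
qed

end

theorem lemma19:
  fixes G :: "'e embedded_graph" and C :: "'e dart list multiset" and F :: "complex set"
  assumes "half_plane_graph G"
    and "curve_system G C"
    and "\<forall>c\<in>#C. proper_curve G c"
    and "balanced G C"
    and "F \<in> faces G"
  shows "enat (nat \<bar>depth G C F\<bar>) \<le> integral_depth G F"
proof -
  interpret plane_graph G
    by unfold_locales (rule assms(1))
  show ?thesis
    unfolding integral_depth_def
    \<comment> \<open>The bound holds for every walk length and so for the infimum, which is
      infinite if there is no walk.\<close>
    using depth_le_walk_length[OF assms(2-4)] by (force intro!: INF_greatest)
qed

end
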